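(* Let $\underline Q$ be a lower transition rate operator, let $t,s\in\mathbb R_{\ge0}$ be such that $t\le s$, and let $L_t^s$ be the lower transition operator corresponding to $\underline Q$. Then for any $f\in\mathcal L(\mathcal X)$ and $\epsilon>0$, if $n\in\mathbb N$ is such that $$n\ge\max\Bigl\{(s-t)\|\underline Q\|,\ \frac1{2\epsilon}(s-t)^2\|\underline Q\|^2\|f\|_{\mathrm v}\Bigr\},$$ with $\|f\|_{\mathrm v}=\max f-\min f$, then $$\Bigl\|L_t^sf-\prod_{i=1}^n(I+\Delta\underline Q)f\Bigr\|\le\epsilon,$$ with $\Delta=(s-t)/n$.
   Context: $\mathbb N=\{1,2,\dots\}$. $\mathcal X$ is a fixed finite non-empty set; $\mathcal L(\mathcal X)$ is the set of all $f:\mathcal X\to\mathbb R$, with $\|f\|=\max_x|f(x)|$; inequalities between functions are pointwise. A non-negatively homogeneous operator $A:\mathcal L(\mathcal X)\to\mathcal L(\mathcal X)$ has norm $\|A\|=\sup\{\|Af\|:\|f\|=1\}$. $I$ is the identity. Products of operators are compositions. A lower transition rate operator is a map $\underline Q:\mathcal L(\mathcal X)\to\mathcal L(\mathcal X)$ such that for all $f,g\in\mathcal L(\mathcal X)$, $\lambda\ge0$, constant functions $\mu$ and $x,y\in\mathcal X$: $[\underline Q\mu](x)=0$; $[\underline Q\mathbb I_y](x)\ge0$ if $x\ne y$; $\underline Q(f+g)\ge\underline Qf+\underline Qg$; $\underline Q(\lambda f)=\lambda\underline Qf$. A lower transition operator is a map $\underline T:\mathcal L(\mathcal X)\to\mathcal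 L(\mathcal X)$ with $[\underline Tf](x)\ge\min f$, $\underline T(f+g)\ge\underline Tf+\underline Tg$ and $\underline T(\lambda f)=\lambda\underline Tf$ for $\lambda\ge0$. For $t\le s$, $\mathcal U_{[t,s]}$ is the set of finite sequences $u:\ t=t_0<t_1<\dots<t_k=s$; $\Delta_i=t_i-t_{i-1}$, $\sigma(u)=\max_i\Delta_i$ ($0$ if $k=0$), $\Phi_u=(I+\Delta_1\underline Q)\cdots(I+\Delta_k\underline Q)$ ($I$ if $k=0$). The lower transition operator $L_t^s$ corresponding to $\underline Q$ is the (existing, unique) lower transition operator such that for every $\epsilon>0$ there is $\delta>0$ with $\|L_t^s-\Phi_u\|\le\epsilon$ for all $u\in\mathcal U_{[t,s]}$ with $\sigma(u)\le\delta$. *)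

theory Defs
  imports Complex_Main "HOL-Library.Indicator_Function"
begin

text \<open>The finite non-empty set \<open>\<X>\<close> is a type of class \<^class>\<open>finite\<close>, and
  \<open>\<L>(\<X>)\<close> is the function type \<open>'a \<Rightarrow> real\<close>.\<close>

type_synonym 'a operator = "('a \<Rightarrow> real) \<Rightarrow> ('a \<Rightarrow> real)"

definition max_norm :: "('a::finite \<Rightarrow> real) \<Rightarrow> real" where
  "max_norm f = Max (range (\<lambda>x. \<bar>f x\<bar>))"

definition variation_norm :: "('a::finite \<Rightarrow> real) \<Rightarrow> real" where
  "variation_norm f = Max (range f) - Min (range f)"

text \<open>The supremum is that of the reals, so the value is meaningful only if the set is bounded
  above. This is the case for lower transition (rate) operators: they are superadditive and
  non-negatively homogeneous on a finite-dimensional space. It then also holds for the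
  compositions \<open>euler_product Q u\<close> below and for their differences with a lower transition
  operator.\<close>

definition op_norm :: "('a::finite) operator \<Rightarrow> real" where
  "op_norm A = Sup {max_norm (A f) | f. max_norm f = 1}"

definition lower_rate_operator :: "('a::finite) operator \<Rightarrow> bool" where
  "lower_rate_operator Q \<longleftrightarrow>
     (\<forall>(\<mu>::real) x. Q (\<lambda>_. \<mu>) x = 0) \<and>
     (\<forall>x y. x \<noteq> y \<longrightarrow> Q (indicator {y}) x \<ge> 0) \<and>
     (\<forall>f g x. Q (\<lambda>z. f z + g z) x \<ge> Q f x + Q g x) \<and>
     (\<forall>(c::real) f x. c \<ge> 0 \<longrightarrow> Q (\<lambda>z. c * f z) x = c * Q f x)"

definition lower_transition_operator :: "('a::finite) operator \<Rightarrow> bool" where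
  "lower_transition_operator T \<longleftrightarrow>
     (\<forall>f x. T f x \<ge> Min (range f)) \<and>
     (\<forall>f g x. T (\<lambda>z. f z + g z) x \<ge> T f x + T g x) \<and>
     (\<forall>(c::real) f x. c \<ge> 0 \<longrightarrow> T (\<lambda>z. c * f z) x = c * T f x)"

text \<open>A sequence \<open>t = t\<^sub>0 < \<dots> < t\<^sub>k = s\<close> is the list \<open>[t\<^sub>0, \<dots>, t\<^sub>k]\<close>
  of length \<open>k + 1\<close>.\<close>

definition partitions :: "real \<Rightarrow> real \<Rightarrow> real list set" where
  "partitions t s = {u. u \<noteq> [] \<and> hd u = t \<and> last u = s \<and> sorted_wrt (<) u}"

text \<open>The list \<open>[\<Delta>\<^sub>1, \<dots>, \<Delta>\<^sub>k]\<close> with \<open>\<Delta>\<^sub>i = t\<^sub>i - t\<^sub>i\<^sub>-\<^sub>1\<close>;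
  \<^const>\<open>map2\<close> stops at the end of the shorter list \<open>tl u\<close>.\<close>

definition increments :: "real list \<Rightarrow> real list" where
  "increments u = map2 (-) (tl u) u"

definition mesh :: "real list \<Rightarrow> real" where
  "mesh u = (if increments u = [] then 0 else Max (set (increments u)))"

definition euler_step :: "'a operator \<Rightarrow> real \<Rightarrow> 'a operator" where
  "euler_step Q \<Delta> = (\<lambda>f x. f x + \<Delta> * Q f x)"

text \<open>\<open>\<Phi>\<^sub>u = (I + \<Delta>\<^sub>1 Q) \<circ> \<dots> \<circ> (I + \<Delta>\<^sub>k Q)\<close>; the last factor acts first.\<close>

definition euler_product :: "'a operator \<Rightarrow> real list \<Rightarrow> 'a operator" where
  "euler_product Q u = foldr (\<lambda>\<Delta> A. euler_step Q \<Delta> \<circ> A) (increments u) id"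

text \<open>This condition characterises \<open>L\<^sub>t\<^sup>s\<close>: for a lower transition rate operator \<open>Q\<close> and
  \<open>t \<le> s\<close> there is exactly one such \<open>L\<close>.\<close>

definition corresponding_transition_operator ::
    "('a::finite) operator \<Rightarrow> real \<Rightarrow> real \<Rightarrow> 'a operator \<Rightarrow> bool" where
  "corresponding_transition_operator Q t s L \<longleftrightarrow>
     lower_transition_operator L \<and>
     (\<forall>\<epsilon>>0. \<exists>\<delta>>0. \<forall>u\<in>partitions t s. mesh u \<le> \<delta> \<longrightarrow>
        op_norm (\<lambda>f x. L f x - euler_product Q u f x) \<le> \<epsilon>)"

end

theory Submission
  imports Defs
begin

text \<open>
  Write \<open>S\<^sub>h = I + h Q\<close> and \<open>q = \<parallel>Q\<parallel>\<close>. Superadditivity makes \<open>Q\<close> Lipschitz with constant \<open>q\<close>, and since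
  \<open>Q\<close> ignores additive constants, \<open>\<parallel>Q f\<parallel> \<le> q \<parallel>f\<parallel>\<^sub>v / 2\<close>. For \<open>h q \<le> 1\<close> the operator \<open>S\<^sub>h\<close> is bounded
  below by the minimum of its argument, hence non-expansive and non-increasing on \<open>\<parallel>\<cdot>\<parallel>\<^sub>v\<close>. Therefore
  \<open>\<parallel>S\<^sub>h\<^sup>j f - f\<parallel> \<le> j h q \<parallel>f\<parallel>\<^sub>v / 2\<close>, and summing \<open>h (Q S\<^sub>h\<^sup>j f - Q f)\<close> over \<open>j < k\<close> yields
  \<open>\<parallel>S\<^sub>h\<^sup>k f - S\<^sub>k\<^sub>h f\<parallel> \<le> (k h q)\<^sup>2 \<parallel>f\<parallel>\<^sub>v / 4\<close>. Splitting each of the \<open>n\<close> steps of length \<open>\<Delta>\<close> into \<open>k\<close>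
  substeps and telescoping gives an error of at most \<open>n (\<Delta> q)\<^sup>2 \<parallel>f\<parallel>\<^sub>v / 4 \<le> \<epsilon> / 2\<close>, uniformly in \<open>k\<close>;
  letting \<open>k\<close> tend to infinity turns the refined product into \<open>L\<close>.
\<close>

section \<open>Norms\<close>

lemma max_norm_le_iff: "max_norm f \<le> c \<longleftrightarrow> (\<forall>x. \<bar>f x\<bar> \<le> c)"
  unfolding max_norm_def by (subst Max_le_iff) auto

lemma abs_le_max_norm: "\<bar>f x\<bar> \<le> max_norm f"
  unfolding max_norm_def by (rule Max_ge) auto

lemma max_norm_nonneg: "0 \<le> max_norm f"
  using abs_le_max_norm[of f] abs_ge_zero order_trans by blast

lemma max_norm_eq: "\<lbrakk>\<And>x. \<bar>f x\<bar> \<le> c; \<bar>f y\<bar> = c\<rbrakk> \<Longrightarrow> max_norm f = c"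
  by (metis abs_le_max_norm max_norm_le_iff order_antisym)

lemma max_norm_scale:
  assumes "0 \<le> c"
  shows "max_norm (\<lambda>x. c * f x) = c * max_norm f"
proof -
  have "max_norm f \<in> range (\<lambda>x. \<bar>f x\<bar>)"
    unfolding max_norm_def by (rule Max_in) auto
  then obtain y where "\<bar>f y\<bar> = max_norm f"
    by (metis imageE)
  then show ?thesis
    by (intro max_norm_eq[where y = y])
      (simp_all add: abs_mult assms abs_le_max_norm mult_left_mono)
qed

lemma variation_norm_nonneg: "0 \<le> variation_norm f"
  unfolding variation_norm_def
  using order_trans[OF Min_le[OF finite_imageI[OF finite] rangeI, of f]
      Max_ge[OF finite_imageI[OF finite] rangeI, of f]] by simp

text \<open>Subtracting the midpoint of the range makes the extreme values symmetric about 0. This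
  is the source of the factor 1/2 in every later bound by \<open>variation_norm f\<close>.\<close>

lemma max_norm_centre:
  "max_norm (\<lambda>x. f x + - ((Max (range f) + Min (range f)) / 2)) \<le> variation_norm f / 2"
proof -
  have "\<bar>f x + - ((Max (range f) + Min (range f)) / 2)\<bar> \<le> (Max (range f) - Min (range f)) / 2" for x
    using Min_le[OF finite_imageI[OF finite] rangeI, of f x]
      Max_ge[OF finite_imageI[OF finite] rangeI, of f x]
    by (intro abs_leI) (simp_all add: field_simps)
  then show ?thesis
    unfolding max_norm_le_iff variation_norm_def by blast
qed

lemma variation_norm_mono:
  assumes "\<And>x. Min (range f) \<le> g x" "\<And>x. g x \<le> Max (range f)"
  shows "variation_norm g \<le> variation_norm f"
proof -
  have "Max (range g) \<le> Max (range f)" "Min (range f) \<le> Min (range g)"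
    using assms by (auto simp: Max_le_iff Min_ge_iff)
  then show ?thesis
    unfolding variation_norm_def by linarith
qed

section \<open>Homogeneous operators\<close>

text \<open>The bound makes the real supremum in \<open>op_norm\<close> meaningful. The class is
  wide enough to hold \<open>Q\<close>, \<open>L\<close>, Euler products and their differences,
  which need not be superadditive.\<close>

definition bounded_homogeneous :: "('a::finite) operator \<Rightarrow> bool" where
  "bounded_homogeneous A \<longleftrightarrow>
     (\<forall>c\<ge>0. \<forall>f x. A (\<lambda>z. c * f z) x = c * A f x) \<and>
     (\<exists>C\<ge>0. \<forall>f. max_norm (A f) \<le> C * max_norm f)"

lemma bounded_homogeneousI:
  assumes "\<And>c f x. 0 \<le> c \<Longrightarrow> A (\<lambda>z. c * f z) x = c * A f x"
    and "\<And>f x. \<bar>A f x\<bar> \<le> C * max_norm f" and "0 \<le> C"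
  shows "bounded_homogeneous A"
  unfolding bounded_homogeneous_def using assms by (auto simp: max_norm_le_iff)

lemma bounded_homogeneous_bound:
  assumes "bounded_homogeneous A"
  obtains C where "0 \<le> C" "\<And>f x. \<bar>A f x\<bar> \<le> C * max_norm f"
  using assms unfolding bounded_homogeneous_def max_norm_le_iff by blast

lemma bounded_homogeneous_scale:
  "\<lbrakk>bounded_homogeneous A; 0 \<le> c\<rbrakk> \<Longrightarrow> A (\<lambda>z. c * f z) = (\<lambda>x. c * A f x)"
  unfolding bounded_homogeneous_def by blast

lemma bounded_homogeneous_id: "bounded_homogeneous id"
  by (rule bounded_homogeneousI[where C = 1]) (auto simp: abs_le_max_norm)

lemma bounded_homogeneous_comp:
  assumes A: "bounded_homogeneous A" and B: "bounded_homogeneous B"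
  shows "bounded_homogeneous (A \<circ> B)"
proof -
  obtain C where C: "0 \<le> C" "\<And>f x. \<bar>A f x\<bar> \<le> C * max_norm f"
    using bounded_homogeneous_bound[OF A] by blast
  obtain D where D: "0 \<le> D" "\<And>f x. \<bar>B f x\<bar> \<le> D * max_norm f"
    using bounded_homogeneous_bound[OF B] by blast
  show ?thesis
  proof (rule bounded_homogeneousI[where C = "C * D"])
    show "\<bar>(A \<circ> B) f x\<bar> \<le> C * D * max_norm f" for f x
    proof -
      have "max_norm (B f) \<le> D * max_norm f"
        using D(2) by (simp add: max_norm_le_iff)
      then have "C * max_norm (B f) \<le> C * (D * max_norm f)"
        using C(1) by (rule mult_left_mono)
      then show ?thesis
        using C(2)[of "B f" x] by (simp add: mult.assoc)
    qed
  qed (simp_all add: C D A B bounded_homogeneous_scale)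
qed

text \<open>The sign of \<open>c\<close> is free: an Euler step has the form
  \<open>id + h Q\<close>, and the difference of \<open>L\<close> and an Euler product is the case
  \<open>c = -1\<close>.\<close>

lemma bounded_homogeneous_add_scale:
  assumes A: "bounded_homogeneous A" and B: "bounded_homogeneous B"
  shows "bounded_homogeneous (\<lambda>f x. A f x + c * B f x)"
proof -
  obtain C where C: "0 \<le> C" "\<And>f x. \<bar>A f x\<bar> \<le> C * max_norm f"
    using bounded_homogeneous_bound[OF A] by blast
  obtain D where D: "0 \<le> D" "\<And>f x. \<bar>B f x\<bar> \<le> D * max_norm f"
    using bounded_homogeneous_bound[OF B] by blast
  show ?thesis
  proof (rule bounded_homogeneousI[where C = "C + \<bar>c\<bar> * D"])
    show "\<bar>A f x + c * B f x\<bar> \<le> (C + \<bar>c\<bar> * D) * max_norm f" for f x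
    proof -
      have "\<bar>c * B f x\<bar> \<le> \<bar>c\<bar> * (D * max_norm f)"
        unfolding abs_mult using D(2) by (intro mult_left_mono) auto
      then show ?thesis
        using C(2)[of f x] by (simp add: algebra_simps)
    qed
  qed (simp_all add: C D A B bounded_homogeneous_scale algebra_simps)
qed

lemma bounded_homogeneous_euler_step:
  "bounded_homogeneous Q \<Longrightarrow> bounded_homogeneous (euler_step Q h)"
  using bounded_homogeneous_add_scale[OF bounded_homogeneous_id] by (simp add: euler_step_def)

lemma bounded_homogeneous_euler_product:
  assumes "bounded_homogeneous Q"
  shows "bounded_homogeneous (euler_product Q u)"
proof -
  let ?P = "\<lambda>ds. foldr (\<lambda>\<Delta> A. euler_step Q \<Delta> \<circ> A) ds id"
  have "bounded_homogeneous (?P ds)" for ds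
  proof (induction ds)
    case Nil
    show ?case
      unfolding foldr_Nil id_apply[of id] by (rule bounded_homogeneous_id)
  next
    case (Cons d ds)
    have "?P (d # ds) = euler_step Q d \<circ> ?P ds"
      by simp
    then show ?case
      using bounded_homogeneous_comp[OF bounded_homogeneous_euler_step[OF assms] Cons] by metis
  qed
  then show ?thesis
    unfolding euler_product_def .
qed

text \<open>Homogeneity reduces the claim to norm 1, where the supremum is an upper bound. Norm 0
  cannot be normalised, but there any bound \<open>C\<close> forces \<open>A f = 0\<close>.\<close>

lemma op_norm_bound:
  assumes A: "bounded_homogeneous A"
  shows "\<bar>A f x\<bar> \<le> op_norm A * max_norm f"
proof (cases "max_norm f = 0")
  case True
  obtain C where "\<And>f x. \<bar>A f x\<bar> \<le> C * max_norm f"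
    using bounded_homogeneous_bound[OF A] by blast
  from this[of f x] show ?thesis
    by (simp add: True)
next
  case False
  define m where "m = max_norm f"
  have m: "m > 0"
    using False max_norm_nonneg[of f] by (simp add: m_def)
  define g where "g = (\<lambda>z. inverse m * f z)"
  have g: "max_norm g = 1"
    unfolding g_def using m max_norm_scale[of "inverse m" f] by (simp flip: m_def)
  obtain C where "\<And>f x. \<bar>A f x\<bar> \<le> C * max_norm f"
    using bounded_homogeneous_bound[OF A] by blast
  then have "max_norm (A h) \<le> C" if "max_norm h = 1" for h
    unfolding max_norm_le_iff using that by (metis mult.right_neutral)
  then have bdd: "bdd_above {max_norm (A h) | h. max_norm h = 1}"
    by (intro bdd_aboveI[where M = C]) auto
  have "\<bar>A g x\<bar> \<le> max_norm (A g)"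
    by (rule abs_le_max_norm)
  also have "\<dots> \<le> op_norm A"
    unfolding op_norm_def using g by (intro cSup_upper[OF _ bdd]) auto
  finally have "inverse m * \<bar>A f x\<bar> \<le> op_norm A"
    unfolding g_def using m by (simp add: bounded_homogeneous_scale[OF A] abs_mult)
  then show ?thesis
    using m by (simp add: field_simps flip: m_def)
qed

text \<open>The lower bound by the minimum, applied to \<open>f\<close> and to \<open>- f\<close>,
  suffices: superadditivity and \<open>T 0 = 0\<close> turn the bound at \<open>- f\<close> into an
  upper bound at \<open>f\<close>.\<close>

lemma lower_transition_operator_bounded_homogeneous:
  assumes T: "lower_transition_operator T"
  shows "bounded_homogeneous T"
proof (rule bounded_homogeneousI[where C = 1])
  have lower: "- max_norm f \<le> T f x" for f x
  proof -
    have "- max_norm f \<le> Min (range f)"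
      using abs_le_max_norm[of f] by (subst Min_ge_iff) (auto simp: abs_le_iff minus_le_iff)
    also have "\<dots> \<le> T f x"
      using T by (simp add: lower_transition_operator_def)
    finally show ?thesis .
  qed
  have "T (\<lambda>z. 0 * f z) x = 0 * T f x" for f x
    using T order_refl unfolding lower_transition_operator_def by blast
  then have zero: "T (\<lambda>_. 0) x = 0" for x
    by simp
  have "T f x + T (\<lambda>z. - f z) x \<le> T (\<lambda>z. f z + - f z) x" for f x
    using T unfolding lower_transition_operator_def by blast
  then have upper: "T f x + T (\<lambda>z. - f z) x \<le> 0" for f x
    by (simp add: zero)
  have "max_norm (\<lambda>z. - f z) = max_norm f" for f :: "'a \<Rightarrow> real"
    by (simp add: max_norm_def)
  then show "\<bar>T f x\<bar> \<le> 1 * max_norm f" for f x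
    using lower[of f x] lower[of "\<lambda>z. - f z" x] upper[of f x] by (simp add: abs_le_iff)
qed (use T in \<open>auto simp: lower_transition_operator_def\<close>)

section \<open>Lower transition rate operators\<close>

locale lower_rate =
  fixes Q :: "('a::finite) operator"
  assumes lower_rate: "lower_rate_operator Q"
begin

lemma const: "Q (\<lambda>_. \<mu>) x = 0"
  using lower_rate by (simp add: lower_rate_operator_def)

lemma offdiag_nonneg: "x \<noteq> y \<Longrightarrow> 0 \<le> Q (indicator {y}) x"
  using lower_rate by (simp add: lower_rate_operator_def)

lemma superadd: "Q f x + Q g x \<le> Q (\<lambda>z. f z + g z) x"
  using lower_rate by (simp add: lower_rate_operator_def)

lemma scale: "0 \<le> c \<Longrightarrow> Q (\<lambda>z. c * f z) x = c * Q f x"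
  using lower_rate by (simp add: lower_rate_operator_def)

lemma superadd_sum:
  "finite Y \<Longrightarrow> (\<Sum>y\<in>Y. Q (g y) x) \<le> Q (\<lambda>z. \<Sum>y\<in>Y. g y z) x"
proof (induction Y rule: finite_induct)
  case (insert y Y)
  then show ?case
    using superadd[of "g y" x "\<lambda>z. \<Sum>y\<in>Y. g y z"] by simp
qed (simp add: const)

lemma le_neg_uminus: "Q f x \<le> - Q (\<lambda>z. - f z) x"
  using superadd[of f x "\<lambda>z. - f z"] by (simp add: const)

text \<open>Superadditivity gives one inequality when the constant is added and the converse when it
  is removed again.\<close>

lemma add_const: "Q (\<lambda>z. f z + \<mu>) x = Q f x"
  using superadd[of f x "\<lambda>_. \<mu>"] superadd[of "\<lambda>z. f z + \<mu>" x "\<lambda>_. - \<mu>"]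
  by (simp add: const)

lemma indicator_expansion: "(\<lambda>z. \<Sum>y\<in>UNIV. f y * indicator {y} z) = f"
  for f :: "'a \<Rightarrow> real"
  by (simp add: indicator_def if_distrib[of "(*) _"] cong: if_cong)

text \<open>Expanding \<open>f\<close> in indicators, superadditivity bounds \<open>Q f\<close> from
  below by finitely many values of \<open>Q\<close>; passing to \<open>- f\<close> gives the upper
  bound.\<close>

lemma bounded_homogeneous: "bounded_homogeneous Q"
proof (rule bounded_homogeneousI)
  \<comment> \<open>Only nonnegative scalars can be pulled out of \<open>Q\<close>, so negative
    values of \<open>f\<close> require the negated indicators as well.\<close>
  define c where "c x y = \<bar>Q (indicator {y}) x\<bar> + \<bar>Q (\<lambda>z. - indicator {y} z) x\<bar>" for x y
  define b where "b = (\<Sum>x\<in>UNIV. \<Sum>y\<in>UNIV. c x y)"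
  have c_nonneg: "0 \<le> c x y" for x y
    by (simp add: c_def)
  then show "0 \<le> b"
    unfolding b_def by (intro sum_nonneg)
  have lower: "- (b * max_norm f) \<le> Q f x" for f x
  proof -
    have "- (max_norm f * c x y) \<le> Q (\<lambda>z. f y * indicator {y} z) x" for y
    proof -
      have "\<bar>Q (\<lambda>z. f y * indicator {y} z) x\<bar> \<le> \<bar>f y\<bar> * c x y"
        using scale[of "f y" "indicator {y}" x] scale[of "- f y" "\<lambda>z. - indicator {y} z" x]
        by (cases "0 \<le> f y") (simp_all add: c_def abs_mult mult_left_mono mult_left_mono_neg)
      also have "\<dots> \<le> max_norm f * c x y"
        by (intro mult_right_mono abs_le_max_norm c_nonneg)
      finally show ?thesis
        by linarith
    qed
    then have "(\<Sum>y\<in>UNIV. - (max_norm f * c x y)) \<le> (\<Sum>y\<in>UNIV. Q (\<lambda>z. f y * indicator {y} z) x)"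
      by (intro sum_mono)
    also have "\<dots> \<le> Q f x"
      using superadd_sum[OF finite, of "\<lambda>y z. f y * indicator {y} z" x UNIV] by (simp only: indicator_expansion)
    finally have "- (max_norm f * (\<Sum>y\<in>UNIV. c x y)) \<le> Q f x"
      unfolding sum_negf sum_distrib_left .
    moreover have "(\<Sum>y\<in>UNIV. c x y) \<le> b"
      unfolding b_def by (rule member_le_sum[of x UNIV "\<lambda>x. sum (c x) UNIV"]) (auto intro: sum_nonneg c_nonneg)
    ultimately show ?thesis
      using mult_left_mono[of "sum (c x) UNIV" b "max_norm f"] max_norm_nonneg[of f]
      by (simp add: mult.commute)
  qed
  have "max_norm (\<lambda>z. - f z) = max_norm f" for f :: "'a \<Rightarrow> real"
    by (simp add: max_norm_def)
  then show "\<bar>Q f x\<bar> \<le> b * max_norm f" for f x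
    using lower[of f x] lower[of "\<lambda>z. - f z" x] le_neg_uminus[of f x] by (simp add: abs_le_iff)
qed (rule scale)

section \<open>Estimates for \<open>Q\<close> in terms of its norm\<close>

abbreviation q :: real where "q \<equiv> op_norm Q"

lemma q_bound: "\<bar>Q f x\<bar> \<le> q * max_norm f"
  by (rule op_norm_bound[OF bounded_homogeneous])

lemma max_norm_indicator: "max_norm (indicator {y} :: 'a \<Rightarrow> real) = 1"
  by (rule max_norm_eq[where y = y]) (auto simp: indicator_def)

lemma q_nonneg: "0 \<le> q"
  using q_bound[of "indicator {undefined}" undefined] by (simp add: max_norm_indicator)

lemma variation_bound: "\<bar>Q f x\<bar> \<le> q * variation_norm f / 2"
proof -
  let ?m = "(Max (range f) + Min (range f)) / 2"
  have "\<bar>Q f x\<bar> \<le> q * max_norm (\<lambda>z. f z + - ?m)"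
    using q_bound[of "\<lambda>z. f z + - ?m" x] by (simp only: add_const)
  also have "\<dots> \<le> q * (variation_norm f / 2)"
    by (intro mult_left_mono max_norm_centre q_nonneg)
  finally show ?thesis
    by simp
qed

lemma superdiff: "Q (\<lambda>z. f z - g z) x \<le> Q f x - Q g x"
  using superadd[of g x "\<lambda>z. f z - g z"] by simp

lemma lipschitz: "\<bar>Q f x - Q g x\<bar> \<le> q * max_norm (\<lambda>z. f z - g z)"
proof -
  have "max_norm (\<lambda>z. g z - f z) = max_norm (\<lambda>z. f z - g z)"
    by (simp add: max_norm_def abs_minus_commute)
  then show ?thesis
    using superdiff[of f g x] superdiff[of g f x]
      q_bound[of "\<lambda>z. f z - g z" x] q_bound[of "\<lambda>z. g z - f z" x] by auto
qed

lemma lower_diag: "(\<And>z. 0 \<le> g z) \<Longrightarrow> - (q * g x) \<le> Q g x"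
proof -
  assume g: "\<And>z. 0 \<le> g z"
  have "- q \<le> Q (indicator {x}) x"
    using q_bound[of "indicator {x}" x] by (simp add: max_norm_indicator)
  then have "g x * - q \<le> g x * Q (indicator {x}) x"
    using g by (rule mult_left_mono)
  also have "\<dots> \<le> (\<Sum>y\<in>UNIV. g y * Q (indicator {y}) x)"
    by (subst sum.remove[of UNIV x]) (auto intro!: sum_nonneg mult_nonneg_nonneg g offdiag_nonneg)
  also have "\<dots> = (\<Sum>y\<in>UNIV. Q (\<lambda>z. g y * indicator {y} z) x)"
    using g by (simp add: scale)
  also have "\<dots> \<le> Q g x"
    using superadd_sum[OF finite, of "\<lambda>y z. g y * indicator {y} z" x UNIV] by (simp only: indicator_expansion)
  finally show ?thesis
    by (simp add: mult.commute)
qed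

section \<open>Euler steps that are short relative to the norm of \<open>Q\<close>\<close>

context
  fixes h :: real
  assumes h: "0 \<le> h" "h * q \<le> 1"
begin

abbreviation S :: "'a operator" where "S \<equiv> euler_step Q h"

text \<open>For \<open>f\<close> shifted to have minimum 0, \<open>lower_diag\<close> limits the
  loss at \<open>x\<close> to the fraction \<open>h * q\<close> of the value there, and this
  fraction is at most 1.\<close>

lemma step_ge_Min: "Min (range f) \<le> S f x"
proof -
  define m where "m = Min (range f)"
  have nonneg: "0 \<le> f z + - m" for z
    using Min_le[OF finite_imageI[OF finite] rangeI, of f z] unfolding m_def by linarith
  have "- (q * (f x + - m)) \<le> Q f x"
    using lower_diag[of "\<lambda>z. f z + - m" x, OF nonneg] by (simp only: add_const)
  then have "h * - (q * (f x + - m)) \<le> h * Q f x"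
    using h(1) by (rule mult_left_mono)
  moreover have "h * q * (f x + - m) \<le> 1 * (f x + - m)"
    using h(2) nonneg by (rule mult_right_mono)
  ultimately show ?thesis
    by (simp add: euler_step_def algebra_simps flip: m_def)
qed

lemma step_le_Max: "S f x \<le> Max (range f)"
proof -
  have "- Max (range f) \<le> Min (range (\<lambda>z. - f z))"
    by (subst Min_ge_iff) auto
  also have "\<dots> \<le> S (\<lambda>z. - f z) x"
    by (rule step_ge_Min)
  also have "\<dots> \<le> - S f x"
    using mult_left_mono[OF le_neg_uminus[of f x] h(1)] by (simp add: euler_step_def)
  finally show ?thesis
    by linarith
qed

lemma variation_norm_step: "variation_norm (S f) \<le> variation_norm f"
  by (rule variation_norm_mono[OF step_ge_Min step_le_Max])

lemma variation_norm_step_power: "variation_norm ((S ^^ j) f) \<le> variation_norm f"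
  by (induction j) (auto intro: order_trans[OF variation_norm_step])

lemma step_diff_ge: "- max_norm (\<lambda>z. f z - g z) \<le> S f x - S g x"
proof -
  have "- max_norm (\<lambda>z. f z - g z) \<le> Min (range (\<lambda>z. f z - g z))"
    using abs_le_max_norm[of "\<lambda>z. f z - g z"]
    by (subst Min_ge_iff) (auto simp: abs_le_iff minus_le_iff)
  also have "\<dots> \<le> S (\<lambda>z. f z - g z) x"
    by (rule step_ge_Min)
  also have "\<dots> \<le> S f x - S g x"
    using mult_left_mono[OF superdiff[of f g x] h(1)]
    by (simp add: euler_step_def algebra_simps)
  finally show ?thesis .
qed

text \<open>By superadditivity \<open>S f - S g\<close> dominates \<open>S (f - g)\<close>, which is
  at least the minimum of \<open>f - g\<close>; exchanging \<open>f\<close> and \<open>g\<close>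
  gives the other side.\<close>

lemma step_nonexpansive: "max_norm (\<lambda>x. S f x - S g x) \<le> max_norm (\<lambda>x. f x - g x)"
proof -
  have "max_norm (\<lambda>z. g z - f z) = max_norm (\<lambda>z. f z - g z)"
    by (simp add: max_norm_def abs_minus_commute)
  then show ?thesis
    using step_diff_ge[of f g] step_diff_ge[of g f]
    by (auto simp: max_norm_le_iff abs_le_iff algebra_simps)
qed

lemma step_power_nonexpansive:
  "max_norm (\<lambda>x. (S ^^ j) f x - (S ^^ j) g x) \<le> max_norm (\<lambda>x. f x - g x)"
  by (induction j) (auto intro: order_trans[OF step_nonexpansive])

text \<open>Each step moves its argument by at most \<open>h * q / 2\<close> times the variation of
  that argument, and the variation never grows along the iteration.\<close>

lemma step_power_dist: "\<bar>(S ^^ j) f x - f x\<bar> \<le> real j * (h * (q * variation_norm f / 2))"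
proof (induction j arbitrary: x)
  case (Suc j)
  have "\<bar>Q ((S ^^ j) f) x\<bar> \<le> q * variation_norm f / 2"
    using variation_bound[of "(S ^^ j) f" x]
      mult_left_mono[OF variation_norm_step_power[of j f] q_nonneg] by linarith
  from mult_left_mono[OF this h(1)]
  have "\<bar>h * Q ((S ^^ j) f) x\<bar> \<le> h * (q * variation_norm f / 2)"
    using h(1) by (simp only: abs_mult abs_of_nonneg)
  moreover have "(S ^^ Suc j) f x = (S ^^ j) f x + h * Q ((S ^^ j) f) x"
    by (simp add: euler_step_def)
  moreover have "real (Suc j) * (h * (q * variation_norm f / 2))
      = real j * (h * (q * variation_norm f / 2)) + h * (q * variation_norm f / 2)"
    by (simp only: of_nat_Suc distrib_right mult_1_left add.commute)
  ultimately show ?case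
    using Suc[of x] by linarith
qed simp

lemma step_power_vs_long_step:
  "\<bar>(S ^^ k) f x - euler_step Q (real k * h) f x\<bar>
     \<le> (real k * h)\<^sup>2 * q\<^sup>2 * variation_norm f / 4"
proof (induction k)
  case (Suc k)
  let ?v = "variation_norm f"
  have "max_norm (\<lambda>z. (S ^^ k) f z - f z) \<le> real k * (h * (q * ?v / 2))"
    unfolding max_norm_le_iff using step_power_dist by blast
  then have "q * max_norm (\<lambda>z. (S ^^ k) f z - f z) \<le> q * (real k * (h * (q * ?v / 2)))"
    using q_nonneg by (rule mult_left_mono)
  then have "\<bar>Q ((S ^^ k) f) x - Q f x\<bar> \<le> q * (real k * (h * (q * ?v / 2)))"
    using lipschitz[of "(S ^^ k) f" x f] by linarith
  from mult_left_mono[OF this h(1)]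
  have "\<bar>h * (Q ((S ^^ k) f) x - Q f x)\<bar> \<le> h * (q * (real k * (h * (q * ?v / 2))))"
    using h(1) by (simp only: abs_mult abs_of_nonneg)
  moreover have "(S ^^ Suc k) f x - euler_step Q (real (Suc k) * h) f x
      = ((S ^^ k) f x - euler_step Q (real k * h) f x) + h * (Q ((S ^^ k) f) x - Q f x)"
    by (simp add: euler_step_def algebra_simps)
  \<comment> \<open>From \<open>(k + 1)\<^sup>2 = k\<^sup>2 + 2 k + 1\<close>: the term
    \<open>2 k\<close> matches the new error exactly, and the 1 is slack, discarded as
    nonnegative.\<close>
  moreover have "(real (Suc k) * h)\<^sup>2 * q\<^sup>2 * ?v / 4
      = (real k * h)\<^sup>2 * q\<^sup>2 * ?v / 4 + h * (q * (real k * (h * (q * ?v / 2)))) + h\<^sup>2 * q\<^sup>2 * ?v / 4"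
    by (simp add: power2_eq_square algebra_simps)
  moreover have "0 \<le> h\<^sup>2 * q\<^sup>2 * ?v / 4"
    using variation_norm_nonneg[of f] by simp
  ultimately show ?case
    using Suc by linarith
qed (simp add: euler_step_def)

end

text \<open>With \<open>A\<close> for \<open>k\<close> short steps and \<open>B\<close> for one long
  step, split \<open>A\<^sup>n\<^sup>+\<^sup>1 f - B\<^sup>n\<^sup>+\<^sup>1 f\<close> as
  \<open>A A\<^sup>n f - A B\<^sup>n f\<close> plus \<open>(A - B) B\<^sup>n f\<close>.
  Non-expansiveness of \<open>A\<close> controls the first part, the one-step error at
  \<open>B\<^sup>n f\<close> the second. The bound does not depend on \<open>k\<close>.\<close>

lemma refinement_error:
  assumes "0 \<le> \<Delta>" "\<Delta> * q \<le> 1" "1 \<le> k"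
  shows "\<bar>(euler_step Q (\<Delta> / real k) ^^ (k * n)) f x - (euler_step Q \<Delta> ^^ n) f x\<bar>
    \<le> real n * (\<Delta>\<^sup>2 * q\<^sup>2 * variation_norm f / 4)"
proof (induction n arbitrary: x)
  case (Suc n)
  define h where "h = \<Delta> / real k"
  have "h \<le> \<Delta>"
    using assms by (simp add: h_def field_simps mult_le_cancel_left1)
  then have h: "0 \<le> h" "h * q \<le> 1"
    using assms mult_right_mono[OF _ q_nonneg, of h \<Delta>] by (auto simp: h_def)
  have kh: "real k * h = \<Delta>"
    using assms(3) by (simp add: h_def)
  define A where "A = euler_step Q h ^^ k"
  define B where "B = euler_step Q \<Delta>"
  define c where "c = \<Delta>\<^sup>2 * q\<^sup>2 * variation_norm f / 4"
  have "\<bar>A ((A ^^ n) f) x - A ((B ^^ n) f) x\<bar>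
      \<le> max_norm (\<lambda>x. A ((A ^^ n) f) x - A ((B ^^ n) f) x)"
    by (rule abs_le_max_norm)
  also have "\<dots> \<le> max_norm (\<lambda>x. (A ^^ n) f x - (B ^^ n) f x)"
    unfolding A_def by (rule step_power_nonexpansive[OF h])
  also have "\<dots> \<le> real n * c"
    unfolding max_norm_le_iff A_def B_def c_def h_def funpow_mult using Suc by blast
  finally have 1: "\<bar>A ((A ^^ n) f) x - A ((B ^^ n) f) x\<bar> \<le> real n * c" .
  have "\<bar>A ((B ^^ n) f) x - B ((B ^^ n) f) x\<bar>
      \<le> \<Delta>\<^sup>2 * q\<^sup>2 * variation_norm ((B ^^ n) f) / 4"
    using step_power_vs_long_step[OF h, of k "(B ^^ n) f" x] by (simp add: A_def B_def kh)
  also have "\<dots> \<le> c"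
    using mult_left_mono[OF variation_norm_step_power[OF assms(1,2), of n f], of "\<Delta>\<^sup>2 * q\<^sup>2"]
    by (simp add: B_def c_def)
  finally have 2: "\<bar>A ((B ^^ n) f) x - B ((B ^^ n) f) x\<bar> \<le> c" .
  have "(euler_step Q (\<Delta> / real k) ^^ (k * Suc n)) f = A ((A ^^ n) f)"
    by (simp add: A_def h_def funpow_add funpow_mult)
  moreover have "(euler_step Q \<Delta> ^^ Suc n) f = B ((B ^^ n) f)"
    by (simp add: B_def)
  ultimately show ?case
    using 1 2 by (simp add: c_def[symmetric] distrib_right)
qed simp

end

section \<open>Uniform partitions\<close>

lemma uniform_partition:
  assumes "t \<le> s" "1 \<le> m"
  obtains u where "u \<in> partitions t s" "mesh u \<le> (s - t) / real m"
    "\<And>Q. euler_product Q u = euler_step Q ((s - t) / real m) ^^ m"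
proof (cases "t = s")
  \<comment> \<open>Strict increase leaves only \<open>[t]\<close>, which has no increments; the two
    products agree because a step of length 0 is the identity.\<close>
  case True
  have id: "euler_step Q 0 = id" for Q :: "'b operator"
    by (auto simp: euler_step_def)
  have "(id ^^ m) = (id :: 'b operator)" for m
    by (induction m) auto
  then show ?thesis
    using True by (intro that[of "[t]"])
      (auto simp: partitions_def mesh_def increments_def euler_product_def id)
next
  case False
  define h where "h = (s - t) / real m"
  have h: "h > 0" "real m * h = s - t"
    using assms False by (auto simp: h_def)
  define u where "u = map (\<lambda>i. t + real i * h) [0..<Suc m]"
  have inc: "increments u = replicate m h"
    unfolding increments_def u_def
    by (rule nth_equalityI) (auto simp: nth_tl algebra_simps simp del: upt_Suc)
  show ?thesis
  proof (rule that[of u])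
    have "sorted_wrt (<) u"
      unfolding u_def sorted_wrt_map
      by (rule sorted_wrt_mono_rel[OF _ sorted_wrt_upt]) (simp add: h)
    moreover have "hd u = t"
      by (simp add: u_def hd_map del: upt_Suc)
    moreover have "last u = s"
      using h by (simp add: u_def)
    ultimately show "u \<in> partitions t s"
      by (simp add: partitions_def u_def)
    show "mesh u \<le> (s - t) / real m"
      using assms by (simp add: mesh_def inc flip: h_def)
    show "euler_product Q u = euler_step Q ((s - t) / real m) ^^ m" for Q :: "'b operator"
    proof -
      have "foldr (\<lambda>\<Delta> A. euler_step Q \<Delta> \<circ> A) (replicate j h) id = euler_step Q h ^^ j" for j
        by (induction j) simp_all
      then show ?thesis
        by (simp add: euler_product_def inc flip: h_def)
    qed
  qed
qed

section \<open>Passage from refined Euler products to \<open>L\<close>\<close>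

theorem proposition8p5:
  fixes Q L :: "('a::finite) operator" and t s \<epsilon> :: real and f :: "'a \<Rightarrow> real" and n :: nat
  assumes "lower_rate_operator Q"
    and "0 \<le> t" and "t \<le> s"
    and "corresponding_transition_operator Q t s L"
    and "\<epsilon> > 0" and "n \<ge> 1"
    and "real n \<ge> max ((s - t) * op_norm Q)
                       (1 / (2 * \<epsilon>) * (s - t)\<^sup>2 * (op_norm Q)\<^sup>2 * variation_norm f)"
  shows "max_norm (\<lambda>x. L f x - ((euler_step Q ((s - t) / real n)) ^^ n) f x) \<le> \<epsilon>"
proof -
  interpret lower_rate Q
    by unfold_locales fact
  define \<Delta> where "\<Delta> = (s - t) / real n"
  have \<Delta>: "0 \<le> \<Delta>" "\<Delta> * q \<le> 1"
    using assms by (auto simp: \<Delta>_def field_simps)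
  \<comment> \<open>Isolates the second entry of the maximum, so that the hypothesis on
    \<open>n\<close> bounds it by \<open>real n\<close>. Half of \<open>\<epsilon>\<close> remains
    for the distance from \<open>L\<close> to the refined product.\<close>
  have "real n * (\<Delta>\<^sup>2 * q\<^sup>2 * variation_norm f / 4)
      = (1 / (2 * \<epsilon>) * (s - t)\<^sup>2 * q\<^sup>2 * variation_norm f) * (\<epsilon> / (2 * real n))"
    using assms(5,6) by (simp add: \<Delta>_def power2_eq_square field_simps)
  also have "\<dots> \<le> real n * (\<epsilon> / (2 * real n))"
    using assms(5,7) by (intro mult_right_mono) auto
  also have "\<dots> = \<epsilon> / 2"
    using assms(6) by simp
  finally have err: "real n * (\<Delta>\<^sup>2 * q\<^sup>2 * variation_norm f / 4) \<le> \<epsilon> / 2" .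
  \<comment> \<open>The summand 1 keeps the denominator positive when \<open>f = 0\<close>, and
    still \<open>\<eta> * max_norm f \<le> \<epsilon> / 2\<close>.\<close>
  define \<eta> where "\<eta> = \<epsilon> / (2 * (max_norm f + 1))"
  have "\<eta> > 0"
    using assms(5) max_norm_nonneg[of f] by (simp add: \<eta>_def)
  then obtain \<delta> where "\<delta> > 0" and \<delta>: "\<And>u. \<lbrakk>u \<in> partitions t s; mesh u \<le> \<delta>\<rbrakk> \<Longrightarrow>
      op_norm (\<lambda>f x. L f x - euler_product Q u f x) \<le> \<eta>"
    using assms(4) unfolding corresponding_transition_operator_def by blast
  \<comment> \<open>Chosen so that the substep \<open>\<Delta> / k\<close> is below the mesh
    \<open>\<delta>\<close> demanded by the convergence to \<open>L\<close>.\<close>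
  obtain k :: nat where k: "\<Delta> / \<delta> < real k" "1 \<le> k"
    using reals_Archimedean2[of "max 1 (\<Delta> / \<delta>)"] by auto
  have h: "(s - t) / real (k * n) = \<Delta> / real k"
    by (simp add: \<Delta>_def mult.commute)
  have mesh: "(s - t) / real (k * n) \<le> \<delta>"
    unfolding h using k \<open>\<delta> > 0\<close> by (simp add: field_simps)
  have "1 \<le> k * n"
    using k(2) assms(6) by simp
  then obtain u where u: "u \<in> partitions t s" "mesh u \<le> (s - t) / real (k * n)"
    "\<And>Q :: 'a operator. euler_product Q u = euler_step Q ((s - t) / real (k * n)) ^^ (k * n)"
    using uniform_partition[OF assms(3)] by metis
  let ?D = "\<lambda>f x. L f x - euler_product Q u f x"
  have "bounded_homogeneous L"
    using assms(4) lower_transition_operator_bounded_homogeneous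
    unfolding corresponding_transition_operator_def by blast
  then have "bounded_homogeneous ?D"
    using bounded_homogeneous_add_scale[of L "euler_product Q u" "- 1"]
      bounded_homogeneous_euler_product[OF bounded_homogeneous] by simp
  then have "\<bar>?D f x\<bar> \<le> op_norm ?D * max_norm f" for x
    by (rule op_norm_bound)
  moreover have "op_norm ?D * max_norm f \<le> \<eta> * max_norm f"
    using \<delta>[OF u(1)] u(2) mesh max_norm_nonneg by (intro mult_right_mono) auto
  moreover have "\<eta> * max_norm f \<le> \<epsilon> / 2"
    using assms(5) max_norm_nonneg[of f] by (simp add: \<eta>_def field_simps)
  ultimately have fine: "\<bar>L f x - (euler_step Q (\<Delta> / real k) ^^ (k * n)) f x\<bar> \<le> \<epsilon> / 2" for x
    unfolding u(3) h by (meson order_trans)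
  have coarse: "\<bar>(euler_step Q (\<Delta> / real k) ^^ (k * n)) f x - (euler_step Q \<Delta> ^^ n) f x\<bar>
      \<le> \<epsilon> / 2" for x
    using refinement_error[OF \<Delta> k(2), of n f x] err by linarith
  have "\<bar>L f x - (euler_step Q \<Delta> ^^ n) f x\<bar> \<le> \<epsilon>" for x
    using fine[of x] coarse[of x] by linarith
  then show ?thesis
    by (simp add: max_norm_le_iff \<Delta>_def)
qed

end
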